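(* Let $p\equiv 1\pmod 6$ be a prime, and for each integer $a$ with $1\leq a\leq p-1$ let $N_{p,a}=\#E_a(\mathbb{F}_p)$ be the number of $\mathbb{F}_p$-rational points (including the point at infinity) of the elliptic curve $E_a: y^{2}=x^{3}+a^{3}$ over $\mathbb{F}_p$. Then $$\sum_{a=1}^{p-1}N_{p,a}=p^{2}-1.$$
   Context: $E_a(\mathbb{F}_p)$ is the set of pairs $(x,y)\in\mathbb{F}_p\times\mathbb{F}_p$ with $y^{2}=x^{3}+a^{3}$, together with one point at infinity. *)

theory Defs
  imports "HOL-Number_Theory.Residues"
begin

datatype 'a curve_point = Infinity | Affine 'a 'a

text \<open>
  The rational points of \<open>y\<^sup>2 = x\<^sup>3 + a\<^sup>3\<close> over the prime field \<open>residue_ring (int p)\<close>,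
  whose carrier is \<open>{0..int p - 1}\<close>. The integer \<open>a\<close> enters through its residue
  \<open>a mod int p\<close>.
\<close>

definition curve_points :: "nat \<Rightarrow> int \<Rightarrow> int curve_point set" where
  "curve_points p a =
    (let F = residue_ring (int p) in
      insert Infinity
        {Affine x y | x y. x \<in> carrier F \<and> y \<in> carrier F \<and>
          y [^]\<^bsub>F\<^esub> (2::nat) = x [^]\<^bsub>F\<^esub> (3::nat) \<oplus>\<^bsub>F\<^esub> (a mod int p) [^]\<^bsub>F\<^esub> (3::nat)})"

definition num_points :: "nat \<Rightarrow> int \<Rightarrow> nat" where
  "num_points p a = card (curve_points p a)"

end

theory Submission
  imports Defs
begin

text \<open>
  Every affine point that is counted is a triple \<open>(a, x, y)\<close> with \<open>a\<close> nonzero and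
  \<open>y\<^sup>2 = x\<^sup>3 + a\<^sup>3\<close>. Writing \<open>x = a u\<close> and \<open>y = a w\<close> and cancelling \<open>a\<^sup>2\<close> turns this into
  \<open>w\<^sup>2 = a (u\<^sup>3 + 1)\<close>, which is linear in the curve parameter \<open>a\<close>. For each \<open>u\<close> it has exactly
  \<open>p - 1\<close> solutions \<open>(a, w)\<close> (\<open>card_square_eq_multiple\<close>), so there are \<open>p (p - 1)\<close> triples
  (\<open>card_cubic_triples\<close>). The points at infinity contribute another \<open>p - 1\<close>, and
  \<open>p (p - 1) + (p - 1) = p\<^sup>2 - 1\<close>.
\<close>

lemma (in field) mult_divide_cancel:
  assumes "a \<in> carrier R" "a \<noteq> \<zero>" "x \<in> carrier R"
  shows "a \<otimes> (inv a \<otimes> x) = x" "inv a \<otimes> (a \<otimes> x) = x"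
  using assms field_Units by (simp_all flip: m_assoc)

text \<open>
  If \<open>c = \<zero>\<close> then \<open>w\<close> must vanish and \<open>a\<close> is free; otherwise \<open>a = w\<^sup>2 / c\<close> is determined by an
  arbitrary nonzero \<open>w\<close>. Both cases give the same count.
\<close>

lemma (in field) card_square_eq_multiple:
  assumes c: "c \<in> carrier R"
  shows "card {(a, w). a \<in> carrier R - {\<zero>} \<and> w \<in> carrier R \<and> w \<otimes> w = a \<otimes> c}
    = card (carrier R - {\<zero>})"
    (is "card ?S = _")
proof (cases "c = \<zero>")
  case True
  have "?S = (\<lambda>a. (a, \<zero>)) ` (carrier R - {\<zero>})"
    using True by (auto simp: integral_iff)
  then show ?thesis
    by (simp add: card_image inj_on_def)
next
  case False
  have inv_c: "inv c \<in> carrier R" "inv c \<noteq> \<zero>"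
    using c False field_Units Units_inv_Units[of c] by auto
  have "?S = (\<lambda>w. (inv c \<otimes> (w \<otimes> w), w)) ` (carrier R - {\<zero>})"
  proof (intro equalityI subsetI)
    fix z assume "z \<in> ?S"
    then obtain a w where z: "z = (a, w)" and a: "a \<in> carrier R" "a \<noteq> \<zero>"
      and w: "w \<in> carrier R" and eq: "w \<otimes> w = a \<otimes> c"
      by auto
    have "inv c \<otimes> (w \<otimes> w) = a"
      using a c False eq mult_divide_cancel(2)[of c a] by (simp add: m_comm)
    moreover have "w \<noteq> \<zero>"
      using a c w eq False integral_iff[of a c] by auto
    ultimately show "z \<in> (\<lambda>w. (inv c \<otimes> (w \<otimes> w), w)) ` (carrier R - {\<zero>})"
      using z w by auto
  next
    fix z assume "z \<in> (\<lambda>w. (inv c \<otimes> (w \<otimes> w), w)) ` (carrier R - {\<zero>})"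
    then obtain w where z: "z = (inv c \<otimes> (w \<otimes> w), w)" and w: "w \<in> carrier R" "w \<noteq> \<zero>"
      by auto
    have "w \<otimes> w = inv c \<otimes> (w \<otimes> w) \<otimes> c"
      using w c inv_c False mult_divide_cancel(1)[of c "w \<otimes> w"]
      by (simp add: m_comm)
    then show "z \<in> ?S"
      using z w inv_c by (simp add: integral_iff)
  qed
  then show ?thesis
    by (simp add: card_image inj_on_def)
qed

text \<open>
  Under the substitution \<open>x = a u\<close>, \<open>y = a w\<close> both sides become divisible by \<open>a\<^sup>2\<close>, and the
  cubic side keeps exactly one further factor \<open>a\<close>.
\<close>

lemma (in field) cubic_eq_rescale:
  assumes "a \<in> carrier R" "a \<noteq> \<zero>" "u \<in> carrier R" "w \<in> carrier R"
  shows "(a \<otimes> w) [^] (2::nat) = (a \<otimes> u) [^] (3::nat) \<oplus> a [^] (3::nat)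
    \<longleftrightarrow> w \<otimes> w = a \<otimes> (u [^] (3::nat) \<oplus> \<one>)"
proof -
  have "(a \<otimes> w) [^] (2::nat) = (a \<otimes> a) \<otimes> (w \<otimes> w)"
    using assms by (simp add: numeral_eq_Suc m_ac)
  moreover have "(a \<otimes> u) [^] (3::nat) \<oplus> a [^] (3::nat)
      = (a \<otimes> a) \<otimes> (a \<otimes> (u [^] (3::nat) \<oplus> \<one>))"
    using assms by (simp add: numeral_eq_Suc r_distr m_ac)
  ultimately show ?thesis
    using assms by (simp add: m_lcancel integral_iff)
qed

text \<open>
  The rescaling \<open>(u, a, w) \<mapsto> (a, a u, a w)\<close> is a bijection because \<open>a\<close> is invertible. Fibring its
  domain over \<open>u\<close> instead of over \<open>a\<close> makes all fibres equally large, although the curves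
  for the individual \<open>a\<close> may have different numbers of points.
\<close>

lemma (in field) card_cubic_triples:
  assumes fin: "finite (carrier R)"
  shows "card {(a, x, y). a \<in> carrier R - {\<zero>} \<and> x \<in> carrier R \<and> y \<in> carrier R
      \<and> y [^] (2::nat) = x [^] (3::nat) \<oplus> a [^] (3::nat)}
    = card (carrier R) * card (carrier R - {\<zero>})"
    (is "card ?T = _")
proof -
  define S where "S u = {(a, w). a \<in> carrier R - {\<zero>} \<and> w \<in> carrier R
      \<and> w \<otimes> w = a \<otimes> (u [^] (3::nat) \<oplus> \<one>)}" for u
  let ?f = "\<lambda>(u, a, w). (a, a \<otimes> u, a \<otimes> w)"
  have inj: "inj_on ?f (Sigma (carrier R) S)"
    by (auto simp: inj_on_def S_def m_lcancel)
  have image: "?f ` Sigma (carrier R) S = ?T"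
  proof (intro equalityI subsetI)
    fix z assume "z \<in> ?f ` Sigma (carrier R) S"
    then show "z \<in> ?T"
      by (auto simp: S_def cubic_eq_rescale)
  next
    fix z assume "z \<in> ?T"
    then obtain a x y where z: "z = (a, x, y)" and a: "a \<in> carrier R" "a \<noteq> \<zero>"
      and xy: "x \<in> carrier R" "y \<in> carrier R"
      and eq: "y [^] (2::nat) = x [^] (3::nat) \<oplus> a [^] (3::nat)"
      by auto
    define u w where "u = inv a \<otimes> x" and "w = inv a \<otimes> y"
    have uw: "u \<in> carrier R" "w \<in> carrier R" and xy_eq: "a \<otimes> u = x" "a \<otimes> w = y"
      using a xy field_Units by (auto simp: u_def w_def mult_divide_cancel)
    have "w \<otimes> w = a \<otimes> (u [^] (3::nat) \<oplus> \<one>)"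
      using cubic_eq_rescale[OF a uw] eq unfolding xy_eq by (rule iffD1)
    then have "(u, a, w) \<in> Sigma (carrier R) S"
      using a uw by (simp add: S_def)
    moreover have "z = ?f (u, a, w)"
      by (simp add: z xy_eq)
    ultimately show "z \<in> ?f ` Sigma (carrier R) S"
      by (rule rev_image_eqI)
  qed
  have "card ?T = card (Sigma (carrier R) S)"
    using card_image[OF inj] unfolding image .
  also have "\<dots> = (\<Sum>u\<in>carrier R. card (S u))"
  proof (rule card_SigmaI[OF fin], intro ballI)
    fix u
    show "finite (S u)"
      by (rule finite_subset[of _ "carrier R \<times> carrier R"]) (auto simp: S_def fin)
  qed
  also have "\<dots> = (\<Sum>u\<in>carrier R. card (carrier R - {\<zero>}))"
    unfolding S_def by (intro sum.cong refl card_square_eq_multiple) simp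
  finally show ?thesis
    by simp
qed

theorem theorem9:
  fixes p :: nat
  assumes "prime p"
    and "[p = 1] (mod 6)"
  shows "(\<Sum>a = 1..int p - 1. int (num_points p a)) = int p ^ 2 - 1"
proof -
  define F where "F = residue_ring (int p)"
  interpret residues_prime p F
    using assms(1) by unfold_locales (simp_all add: F_def)
  have carrier_F: "carrier F = {0..int p - 1}" and zero_F: "\<zero>\<^bsub>F\<^esub> = 0"
    by (simp_all add: F_def residue_ring_def)
  have nonzero_F: "carrier F - {\<zero>\<^bsub>F\<^esub>} = {1..int p - 1}"
    by (auto simp: carrier_F zero_F)
  have p_pos: "p \<ge> 1"
    using prime_ge_1_nat[OF assms(1)] .
  define P where "P a = {(x, y). x \<in> carrier F \<and> y \<in> carrier F
      \<and> y [^]\<^bsub>F\<^esub> (2::nat) = x [^]\<^bsub>F\<^esub> (3::nat) \<oplus>\<^bsub>F\<^esub> a [^]\<^bsub>F\<^esub> (3::nat)}" for a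
  have fin_P: "finite (P a)" for a
    by (rule finite_subset[of _ "carrier F \<times> carrier F"]) (auto simp: P_def carrier_F)
  have num_points_eq: "num_points p a = Suc (card (P a))" if "a \<in> {1..int p - 1}" for a
  proof -
    have "curve_points p a = insert Infinity (case_prod Affine ` P a)"
      using that by (auto simp: curve_points_def P_def Let_def simp flip: F_def)
    moreover have "card (case_prod Affine ` P a) = card (P a)"
      by (intro card_image) (auto simp: inj_on_def)
    moreover have "Infinity \<notin> case_prod Affine ` P a"
      by auto
    ultimately show ?thesis
      by (simp add: num_points_def fin_P)
  qed
  have "(\<Sum>a = 1..int p - 1. card (P a)) = card (Sigma {1..int p - 1} P)"
    by (simp add: fin_P)
  also have "Sigma {1..int p - 1} P = {(a, x, y). a \<in> carrier F - {\<zero>\<^bsub>F\<^esub>}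
      \<and> x \<in> carrier F \<and> y \<in> carrier F
      \<and> y [^]\<^bsub>F\<^esub> (2::nat) = x [^]\<^bsub>F\<^esub> (3::nat) \<oplus>\<^bsub>F\<^esub> a [^]\<^bsub>F\<^esub> (3::nat)}"
    unfolding nonzero_F P_def by auto
  also have "card \<dots> = card (carrier F) * card (carrier F - {\<zero>\<^bsub>F\<^esub>})"
    by (rule card_cubic_triples) (simp add: carrier_F)
  also have "\<dots> = p * (p - 1)"
    unfolding nonzero_F using p_pos by (simp add: carrier_F nat_diff_distrib)
  finally have affine: "(\<Sum>a = 1..int p - 1. card (P a)) = p * (p - 1)" .
  have "(\<Sum>a = 1..int p - 1. int (num_points p a)) = (\<Sum>a = 1..int p - 1. 1 + int (card (P a)))"
    by (intro sum.cong) (simp_all add: num_points_eq)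
  also have "\<dots> = (int p - 1) + int (\<Sum>a = 1..int p - 1. card (P a))"
    using p_pos by (simp add: sum.distrib)
  also have "\<dots> = int p ^ 2 - 1"
    unfolding affine using p_pos by (simp add: of_nat_diff power2_eq_square algebra_simps)
  finally show ?thesis .
qed

end
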